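(* Let $e$ be a constant and, for each index $\mu\in\{0,1,2,3\}$, let $h_\mu(x) = 1/\sqrt{|g^{\mu\mu}(x)|}$ (no sum over $\mu$), let $A_\mu(x)$ be a gauge field with values in the Lie algebra $\mathfrak g$ of a compact Lie group $G$, and let $D_\mu^{(q)} = \partial_\mu + ie\,h_\mu A_\mu$ (no sum over $\mu$). Then the field strength defined by the commutator $F_{\mu\nu}^{(q)} := [D_\mu^{(q)}, D_\nu^{(q)}]$ is given, for all $\mu,\nu$ (no summation over repeated indices), by $$F_{\mu\nu}^{(q)} = ie\left(\partial_\mu(h_\nu A_\nu) - \partial_\nu(h_\mu A_\mu)\right) - e^2 h_\mu h_\nu [A_\mu, A_\nu].$$
   Context: Spacetime is four-dimensional with coordinates $x=(x^0,x^1,x^2,x^3)$ and partial derivatives $\partial_\mu$. The functions $g^{\mu\mu}(x)$ are the diagonal components of a diagonal metric $g^{\mu\nu}(x)=\operatorname{diag}(g^{00},g^{11},g^{22},g^{33})$; they are real-valued, smooth, nowhere-vanishing scalar background fields. The gauge field is $A_\mu(x)=A_\mu^a(x)T^a$, where $T^a$ are generators of $\mathfrak g$ acting (as matrices) on a representation space $V$ of $G$, and the components are smooth. The operators $D_\mu^{(q)}$ act on smooth $V$-valued functions, with $h_\mu A_\mu$ acting by pointwise (matrix) multiplication; the asserted equality is an equality of operators, its right-hand side acting by pointwise multiplication. $[A_\mu,A_\nu]$ is the matrix commutator. No summation over repeated indices is implied. *)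

theory Defs
  imports "HOL-Analysis.Analysis" "HOL-Algebra.Group"
begin

section \<open>Smooth functions\<close>

definition dirderiv :: "'a::real_normed_vector \<Rightarrow> ('a \<Rightarrow> 'b::real_normed_vector) \<Rightarrow> 'a \<Rightarrow> 'b"
  where "dirderiv b f x = vector_derivative (\<lambda>t. f (x + t *\<^sub>R b)) (at 0)"

text \<open>
  \<open>Ck_on k B S f\<close> is meant for a set \<open>B\<close> of standard basis vectors and a set \<open>S\<close> that is open
  in \<open>span B\<close>: all partial derivatives of \<open>f\<close> up to order \<open>k\<close> in the directions of \<open>B\<close> exist and
  are continuous on \<open>S\<close>.  For \<open>B = Basis\<close> this is the usual notion on open sets.  A general
  \<open>B\<close> makes \<open>span B\<close> a model of Euclidean space of dimension \<open>card B\<close>, with \<open>0\<close> allowed.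
\<close>

primrec Ck_on :: "nat \<Rightarrow> 'a::euclidean_space set \<Rightarrow> 'a set \<Rightarrow> ('a \<Rightarrow> 'b::real_normed_vector) \<Rightarrow> bool"
  where
    "Ck_on 0 B S f \<longleftrightarrow> continuous_on S f"
  | "Ck_on (Suc k) B S f \<longleftrightarrow> continuous_on S f \<and>
       (\<forall>b\<in>B. (\<forall>x\<in>S. (\<lambda>t. f (x + t *\<^sub>R b)) differentiable (at 0)) \<and> Ck_on k B S (dirderiv b f))"

definition smooth_on :: "'a::euclidean_space set \<Rightarrow> 'a set \<Rightarrow> ('a \<Rightarrow> 'b::real_normed_vector) \<Rightarrow> bool"
  where "smooth_on B S f \<longleftrightarrow> (\<forall>k. Ck_on k B S f)"


section \<open>Smooth manifolds and Lie groups\<close>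

text \<open>A chart is a pair of its domain and its coordinate map, an atlas a set of charts.\<close>

type_synonym ('g, 'm) atlas = "('g set \<times> ('g \<Rightarrow> 'm)) set"

definition smooth_manifold :: "'g topology \<Rightarrow> 'm::euclidean_space set \<Rightarrow> ('g, 'm) atlas \<Rightarrow> bool"
  where "smooth_manifold X B \<A> \<longleftrightarrow>
    Hausdorff_space X \<and> second_countable X \<and> B \<subseteq> Basis \<and>
    (\<Union>(U, \<phi>)\<in>\<A>. U) = topspace X \<and>
    (\<forall>(U, \<phi>)\<in>\<A>. openin X U \<and> openin (top_of_set (span B)) (\<phi> ` U) \<and>
       homeomorphic_map (subtopology X U) (top_of_set (\<phi> ` U)) \<phi>) \<and>
    (\<forall>(U, \<phi>)\<in>\<A>. \<forall>(V, \<psi>)\<in>\<A>. smooth_on B (\<phi> ` (U \<inter> V)) (\<psi> \<circ> inv_into U \<phi>))"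

definition smooth_map ::
  "'g topology \<Rightarrow> 'm::euclidean_space set \<Rightarrow> ('g, 'm) atlas \<Rightarrow>
   'h topology \<Rightarrow> 'n::euclidean_space set \<Rightarrow> ('h, 'n) atlas \<Rightarrow> ('g \<Rightarrow> 'h) \<Rightarrow> bool"
  where "smooth_map X B \<A> Y C \<B> f \<longleftrightarrow> continuous_map X Y f \<and>
    (\<forall>(U, \<phi>)\<in>\<A>. \<forall>(V, \<psi>)\<in>\<B>.
       smooth_on B (\<phi> ` {x \<in> U. f x \<in> V}) (\<psi> \<circ> f \<circ> inv_into U \<phi>))"

definition smooth_fun :: "'m::euclidean_space set \<Rightarrow> ('g, 'm) atlas \<Rightarrow> ('g \<Rightarrow> 'b::real_normed_vector) \<Rightarrow> bool"
  where "smooth_fun B \<A> f \<longleftrightarrow> (\<forall>(U, \<phi>)\<in>\<A>. smooth_on B (\<phi> ` U) (f \<circ> inv_into U \<phi>))"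

definition prod_dirs :: "'m::euclidean_space set \<Rightarrow> 'n::euclidean_space set \<Rightarrow> ('m \<times> 'n) set"
  where "prod_dirs B C = (\<lambda>b. (b, 0)) ` B \<union> (\<lambda>c. (0, c)) ` C"

definition prod_atlas :: "('g, 'm) atlas \<Rightarrow> ('h, 'n) atlas \<Rightarrow> ('g \<times> 'h, 'm \<times> 'n) atlas"
  where "prod_atlas \<A> \<B> = {(U \<times> V, map_prod \<phi> \<psi>) | U \<phi> V \<psi>. (U, \<phi>) \<in> \<A> \<and> (V, \<psi>) \<in> \<B>}"

definition lie_group ::
  "('g, 'r) monoid_scheme \<Rightarrow> 'g topology \<Rightarrow> 'm::euclidean_space set \<Rightarrow> ('g, 'm) atlas \<Rightarrow> bool"
  where "lie_group G X B \<A> \<longleftrightarrow>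
    Group.group G \<and> topspace X = carrier G \<and> smooth_manifold X B \<A> \<and>
    smooth_map (prod_topology X X) (prod_dirs B B) (prod_atlas \<A> \<A>) X B \<A> (\<lambda>(x, y). x \<otimes>\<^bsub>G\<^esub> y) \<and>
    smooth_map X B \<A> X B \<A> (\<lambda>x. inv\<^bsub>G\<^esub> x)"

definition compact_lie_group ::
  "('g, 'r) monoid_scheme \<Rightarrow> 'g topology \<Rightarrow> 'm::euclidean_space set \<Rightarrow> ('g, 'm) atlas \<Rightarrow> bool"
  where "compact_lie_group G X B \<A> \<longleftrightarrow> lie_group G X B \<A> \<and> compact_space X"

text \<open>
  The Lie algebra of \<open>G\<close> as the space of left-invariant vector fields, i.e. of left-invariant
  derivations of the algebra of smooth real functions on \<open>G\<close>; its bracket is the commutator of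
  derivations.  Functions in HOL are total, so a derivation must not depend on values outside
  the carrier (first conjunct) and is fixed to be \<open>0\<close> where it has no meaning (second conjunct).
\<close>

definition lie_algebra ::
  "('g, 'r) monoid_scheme \<Rightarrow> 'm::euclidean_space set \<Rightarrow> ('g, 'm) atlas \<Rightarrow> (('g \<Rightarrow> real) \<Rightarrow> 'g \<Rightarrow> real) set"
  where "lie_algebra G B \<A> = {\<xi>.
    (\<forall>f f'. smooth_fun B \<A> f \<longrightarrow> smooth_fun B \<A> f' \<longrightarrow> (\<forall>x\<in>carrier G. f x = f' x) \<longrightarrow> \<xi> f = \<xi> f') \<and>
    (\<forall>f x. \<not> smooth_fun B \<A> f \<or> x \<notin> carrier G \<longrightarrow> \<xi> f x = 0) \<and>
    (\<forall>f. smooth_fun B \<A> f \<longrightarrow> smooth_fun B \<A> (\<xi> f)) \<and>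
    (\<forall>f f'. smooth_fun B \<A> f \<longrightarrow> smooth_fun B \<A> f' \<longrightarrow>
       (\<forall>x\<in>carrier G. \<xi> (\<lambda>y. f y + f' y) x = \<xi> f x + \<xi> f' x)) \<and>
    (\<forall>c f. smooth_fun B \<A> f \<longrightarrow> (\<forall>x\<in>carrier G. \<xi> (\<lambda>y. c * f y) x = c * \<xi> f x)) \<and>
    (\<forall>f f'. smooth_fun B \<A> f \<longrightarrow> smooth_fun B \<A> f' \<longrightarrow>
       (\<forall>x\<in>carrier G. \<xi> (\<lambda>y. f y * f' y) x = f x * \<xi> f' x + \<xi> f x * f' x)) \<and>
    (\<forall>f. smooth_fun B \<A> f \<longrightarrow>
       (\<forall>a\<in>carrier G. \<forall>x\<in>carrier G. \<xi> (\<lambda>y. f (a \<otimes>\<^bsub>G\<^esub> y)) x = \<xi> f (a \<otimes>\<^bsub>G\<^esub> x)))}"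

definition lie_algebra_basis ::
  "('g, 'r) monoid_scheme \<Rightarrow> 'm::euclidean_space set \<Rightarrow> ('g, 'm) atlas \<Rightarrow>
   'i set \<Rightarrow> ('i \<Rightarrow> ('g \<Rightarrow> real) \<Rightarrow> 'g \<Rightarrow> real) \<Rightarrow> bool"
  where "lie_algebra_basis G B \<A> I t \<longleftrightarrow>
    finite I \<and> (\<forall>a\<in>I. t a \<in> lie_algebra G B \<A>) \<and>
    (\<forall>c :: 'i \<Rightarrow> real. (\<forall>f x. (\<Sum>a\<in>I. c a * t a f x) = 0) \<longrightarrow> (\<forall>a\<in>I. c a = 0)) \<and>
    (\<forall>\<xi>\<in>lie_algebra G B \<A>. \<exists>c :: 'i \<Rightarrow> real. \<forall>f x. \<xi> f x = (\<Sum>a\<in>I. c a * t a f x))"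

definition lie_group_rep ::
  "('g, 'r) monoid_scheme \<Rightarrow> 'm::euclidean_space set \<Rightarrow> ('g, 'm) atlas \<Rightarrow> ('g \<Rightarrow> complex^'n^'n) \<Rightarrow> bool"
  where "lie_group_rep G B \<A> \<rho> \<longleftrightarrow>
    smooth_fun B \<A> \<rho> \<and> \<rho> \<one>\<^bsub>G\<^esub> = mat 1 \<and>
    (\<forall>x\<in>carrier G. \<forall>y\<in>carrier G. \<rho> (x \<otimes>\<^bsub>G\<^esub> y) = \<rho> x ** \<rho> y)"

text \<open>
  The induced representation of the Lie algebra: the differential of \<open>\<rho>\<close> at the identity in the
  direction of \<open>\<xi>\<close>, computed on real and imaginary parts of the matrix entries.
\<close>

definition lie_algebra_rep ::
  "('g, 'r) monoid_scheme \<Rightarrow> ('g \<Rightarrow> complex^'n^'n) \<Rightarrow> (('g \<Rightarrow> real) \<Rightarrow> 'g \<Rightarrow> real) \<Rightarrow> complex^'n^'n"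
  where "lie_algebra_rep G \<rho> \<xi> =
    (\<chi> i j. Complex (\<xi> (\<lambda>x. Re (\<rho> x $ i $ j)) \<one>\<^bsub>G\<^esub>) (\<xi> (\<lambda>x. Im (\<rho> x $ i $ j)) \<one>\<^bsub>G\<^esub>))"


section \<open>Gauge fields on four-dimensional spacetime\<close>

text \<open>
  Coordinates are vectors in \<open>real^4\<close>.  The elements of the index type \<open>4\<close> are \<open>0, 1, 2, 3\<close>
  (arithmetic on it is modulo 4, but is never used).
\<close>

definition pderiv4 :: "4 \<Rightarrow> (real^4 \<Rightarrow> 'b::real_normed_vector) \<Rightarrow> real^4 \<Rightarrow> 'b"
  where "pderiv4 \<mu> f x = dirderiv (axis \<mu> 1) f x"

definition cscale :: "complex \<Rightarrow> complex^'n^'m \<Rightarrow> complex^'n^'m"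
  where "cscale c M = (\<chi> i j. c * M $ i $ j)"

definition mat_commutator :: "complex^'n^'n \<Rightarrow> complex^'n^'n \<Rightarrow> complex^'n^'n"
  where "mat_commutator M N = M ** N - N ** M"

definition op_commutator ::
  "(('p \<Rightarrow> 'v) \<Rightarrow> 'p \<Rightarrow> 'v) \<Rightarrow> (('p \<Rightarrow> 'v) \<Rightarrow> 'p \<Rightarrow> 'v) \<Rightarrow> ('p \<Rightarrow> 'v) \<Rightarrow> 'p \<Rightarrow> 'v::ab_group_add"
  where "op_commutator P Q \<psi> x = P (Q \<psi>) x - Q (P \<psi>) x"

definition hfac :: "(real^4 \<Rightarrow> real^4^4) \<Rightarrow> 4 \<Rightarrow> real^4 \<Rightarrow> real"
  where "hfac g \<mu> x = 1 / sqrt \<bar>g x $ \<mu> $ \<mu>\<bar>"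

definition gauge_field ::
  "'i set \<Rightarrow> ('i \<Rightarrow> complex^'n^'n) \<Rightarrow> (4 \<Rightarrow> 'i \<Rightarrow> real^4 \<Rightarrow> real) \<Rightarrow> 4 \<Rightarrow> real^4 \<Rightarrow> complex^'n^'n"
  where "gauge_field I T \<alpha> \<mu> x = (\<Sum>a\<in>I. \<alpha> \<mu> a x *\<^sub>R T a)"

definition cov_deriv ::
  "complex \<Rightarrow> (4 \<Rightarrow> real^4 \<Rightarrow> real) \<Rightarrow> (4 \<Rightarrow> real^4 \<Rightarrow> complex^'n^'n) \<Rightarrow> 4 \<Rightarrow>
   (real^4 \<Rightarrow> complex^'n) \<Rightarrow> real^4 \<Rightarrow> complex^'n"
  where "cov_deriv e h A \<mu> \<psi> x = pderiv4 \<mu> \<psi> x + (\<i> * e) *s ((h \<mu> x *\<^sub>R A \<mu> x) *v \<psi> x)"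

definition field_strength ::
  "complex \<Rightarrow> (4 \<Rightarrow> real^4 \<Rightarrow> real) \<Rightarrow> (4 \<Rightarrow> real^4 \<Rightarrow> complex^'n^'n) \<Rightarrow> 4 \<Rightarrow> 4 \<Rightarrow>
   (real^4 \<Rightarrow> complex^'n) \<Rightarrow> real^4 \<Rightarrow> complex^'n"
  where "field_strength e h A \<mu> \<nu> = op_commutator (cov_deriv e h A \<mu>) (cov_deriv e h A \<nu>)"

end

theory Submission
  imports Defs
begin

text \<open>
  Write \<open>D\<^sub>\<mu> = \<partial>\<^sub>\<mu> + P\<^sub>\<mu>\<close> with the matrix function \<open>P\<^sub>\<mu> = i e h\<^sub>\<mu> A\<^sub>\<mu>\<close>.  By the Leibniz rule
  the terms \<open>P\<^sub>\<nu> \<partial>\<^sub>\<mu>\<psi>\<close> and \<open>P\<^sub>\<mu> \<partial>\<^sub>\<nu>\<psi>\<close> cancel in the commutator, and \<open>\<partial>\<^sub>\<mu>\<partial>\<^sub>\<nu>\<psi> - \<partial>\<^sub>\<nu>\<partial>\<^sub>\<mu>\<psi>\<close> vanishes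
  by Schwarz' theorem, which leaves \<open>\<partial>\<^sub>\<mu>P\<^sub>\<nu> - \<partial>\<^sub>\<nu>P\<^sub>\<mu> + [P\<^sub>\<mu>, P\<^sub>\<nu>]\<close>.
\<close>

section \<open>Directional derivatives and Schwarz' theorem\<close>

lemma dirderiv_has_vector_derivative:
  assumes "(\<lambda>t. f (x + t *\<^sub>R b)) differentiable (at 0)"
  shows "((\<lambda>t. f (x + t *\<^sub>R b)) has_vector_derivative dirderiv b f x) (at 0)"
  using assms vector_derivative_works unfolding dirderiv_def by blast

lemma dirderiv_eqI:
  assumes "((\<lambda>t. f (x + t *\<^sub>R b)) has_vector_derivative d) (at 0)"
  shows "dirderiv b f x = d"
  using assms unfolding dirderiv_def by (rule vector_derivative_at)

text \<open>\<open>dirderiv\<close> looks only at the parameter value 0. Shifting the parameter by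
  \<open>s\<close> with the chain rule gives the derivative at every parameter of the line, as the
  mean value theorem requires.\<close>

lemma has_vector_derivative_along_line:
  assumes "(\<lambda>t. f (x + s *\<^sub>R b + t *\<^sub>R b)) differentiable (at 0)"
  shows "((\<lambda>t. f (x + t *\<^sub>R b)) has_vector_derivative dirderiv b f (x + s *\<^sub>R b)) (at s)"
proof -
  have "((\<lambda>t. t - s) has_vector_derivative 1) (at s)"
    by (auto intro!: derivative_eq_intros)
  moreover have "((\<lambda>t. f (x + s *\<^sub>R b + t *\<^sub>R b)) has_vector_derivative
      dirderiv b f (x + s *\<^sub>R b)) (at (s - s))"
    using dirderiv_has_vector_derivative[OF assms] by simp
  ultimately have "((\<lambda>t. f (x + s *\<^sub>R b + t *\<^sub>R b)) \<circ> (\<lambda>t. t - s) has_vector_derivative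
      1 *\<^sub>R dirderiv b f (x + s *\<^sub>R b)) (at s)"
    by (rule vector_diff_chain_at)
  moreover have "x + s *\<^sub>R b + (t - s) *\<^sub>R b = x + t *\<^sub>R b" for t
    by (simp add: algebra_simps)
  ultimately show ?thesis
    by (simp add: o_def)
qed

text \<open>
  The second difference is symmetric in \<open>b\<close> and \<open>c\<close>, so this limit identifies both mixed
  derivatives.  The inner product with \<open>u\<close> makes the mean value theorem applicable.
\<close>

lemma second_difference_tendsto:
  fixes f :: "'a::real_normed_vector \<Rightarrow> 'b::real_inner"
  assumes "open S" "x \<in> S"
    and f: "\<And>y. y \<in> S \<Longrightarrow> (\<lambda>t. f (y + t *\<^sub>R b)) differentiable (at 0)"
    and df: "\<And>y. y \<in> S \<Longrightarrow> (\<lambda>t. dirderiv b f (y + t *\<^sub>R c)) differentiable (at 0)"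
    and cont: "continuous_on S (dirderiv c (dirderiv b f))"
  shows "((\<lambda>s. ((f (x + s *\<^sub>R b + s *\<^sub>R c) - f (x + s *\<^sub>R b) - f (x + s *\<^sub>R c) + f x) \<bullet> u) / (s * s))
    \<longlongrightarrow> dirderiv c (dirderiv b f) x \<bullet> u) (at_right 0)" (is "(?Q \<longlongrightarrow> ?L) _")
proof (rule tendstoI)
  fix \<epsilon> :: real
  assume "\<epsilon> > 0"
  define H where "H = (\<lambda>y. dirderiv c (dirderiv b f) y \<bullet> u)"
  have "isCont H x"
    unfolding H_def using cont \<open>open S\<close> \<open>x \<in> S\<close>
    by (intro continuous_intros) (simp add: continuous_on_eq_continuous_at)
  then obtain r1 where r1: "r1 > 0" "\<And>y. dist y x < r1 \<Longrightarrow> dist (H y) (H x) < \<epsilon>"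
    using \<open>\<epsilon> > 0\<close> unfolding continuous_at_eps_delta by blast
  obtain r2 where r2: "r2 > 0" "\<And>y. dist y x < r2 \<Longrightarrow> y \<in> S"
    using \<open>open S\<close> \<open>x \<in> S\<close> unfolding open_dist by blast
  \<comment> \<open>For \<open>s < \<delta>\<close> the whole parallelogram of points
    \<open>x + p *\<^sub>R b + q *\<^sub>R c\<close> with \<open>p\<close>, \<open>q\<close> in
    \<open>[0, s]\<close> lies in both balls. The summand 1 keeps the denominator positive even if
    \<open>b\<close> and \<open>c\<close> vanish.\<close>
  define \<delta> where "\<delta> = min r1 r2 / (norm b + norm c + 1)"
  have n: "norm b + norm c + 1 > 0"
    by (smt (verit) norm_ge_zero)
  have "\<delta> > 0"
    using r1 r2 n by (simp add: \<delta>_def)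
  have near: "dist (x + p *\<^sub>R b + q *\<^sub>R c) x < min r1 r2"
    if "0 \<le> p" "p \<le> s" "0 \<le> q" "q \<le> s" "0 < s" "s < \<delta>" for p q s
  proof -
    have "dist (x + p *\<^sub>R b + q *\<^sub>R c) x \<le> p * norm b + q * norm c"
      using that norm_triangle_ineq[of "p *\<^sub>R b" "q *\<^sub>R c"] by (simp add: dist_norm algebra_simps)
    also have "\<dots> \<le> s * norm b + s * norm c"
      using that by (intro add_mono mult_right_mono) auto
    also have "\<dots> < s * (norm b + norm c + 1)"
      using that by (simp add: algebra_simps)
    also have "\<dots> < min r1 r2"
      using that n by (simp add: \<delta>_def pos_less_divide_eq)
    finally show ?thesis .
  qed
  have "dist (?Q s) ?L < \<epsilon>" if s: "0 < s" "s < \<delta>" for s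
  proof -
    \<comment> \<open>The second difference is the increment of \<open>?\<phi>\<close> from 0 to
      \<open>s\<close>, so a first mean value argument in direction \<open>b\<close> turns it into a
      simple difference of \<open>dirderiv b f\<close> in direction \<open>c\<close>.\<close>
    let ?\<phi> = "\<lambda>p. (f (x + p *\<^sub>R b + s *\<^sub>R c) - f (x + p *\<^sub>R b)) \<bullet> u"
    let ?\<phi>' = "\<lambda>p. (dirderiv b f (x + p *\<^sub>R b + s *\<^sub>R c) - dirderiv b f (x + p *\<^sub>R b)) \<bullet> u"
    have "(?\<phi> has_real_derivative ?\<phi>' p) (at p)" if p: "0 \<le> p" "p \<le> s" for p
    proof -
      have "((\<lambda>p. f (x + s *\<^sub>R c + p *\<^sub>R b)) has_vector_derivative dirderiv b f (x + s *\<^sub>R c + p *\<^sub>R b)) (at p)"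
        using near[of p s s] p s r2 by (intro has_vector_derivative_along_line f) (simp add: algebra_simps)
      moreover have "((\<lambda>p. f (x + p *\<^sub>R b)) has_vector_derivative dirderiv b f (x + p *\<^sub>R b)) (at p)"
        using near[of p s 0] p s r2 by (intro has_vector_derivative_along_line f) (simp add: algebra_simps)
      ultimately have "((\<lambda>p. f (x + s *\<^sub>R c + p *\<^sub>R b) - f (x + p *\<^sub>R b)) has_vector_derivative
          (dirderiv b f (x + s *\<^sub>R c + p *\<^sub>R b) - dirderiv b f (x + p *\<^sub>R b))) (at p)"
        by (rule has_vector_derivative_diff)
      from bounded_linear.has_vector_derivative[OF bounded_linear_inner_left this, of u]
      show ?thesis
        by (simp add: has_real_derivative_iff_has_vector_derivative add_ac)
    qed
    then obtain p where p: "0 < p" "p < s" "?\<phi> s - ?\<phi> 0 = (s - 0) * ?\<phi>' p"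
      using MVT2[of 0 s ?\<phi> ?\<phi>'] s by blast
    \<comment> \<open>With \<open>p\<close> fixed, a second mean value argument, now in direction
      \<open>c\<close>, produces the mixed derivative.\<close>
    let ?\<chi> = "\<lambda>q. dirderiv b f (x + p *\<^sub>R b + q *\<^sub>R c) \<bullet> u"
    have "(?\<chi> has_real_derivative H (x + p *\<^sub>R b + q *\<^sub>R c)) (at q)" if q: "0 \<le> q" "q \<le> s" for q
    proof -
      have "((\<lambda>q. dirderiv b f (x + p *\<^sub>R b + q *\<^sub>R c)) has_vector_derivative
          dirderiv c (dirderiv b f) (x + p *\<^sub>R b + q *\<^sub>R c)) (at q)"
        using near[of p s q] p q s r2 by (intro has_vector_derivative_along_line df) simp
      from bounded_linear.has_vector_derivative[OF bounded_linear_inner_left this, of u]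
      show ?thesis
        by (simp add: has_real_derivative_iff_has_vector_derivative H_def)
    qed
    then obtain q where q: "0 < q" "q < s"
        "?\<chi> s - ?\<chi> 0 = (s - 0) * H (x + p *\<^sub>R b + q *\<^sub>R c)"
      using MVT2[of 0 s ?\<chi> "\<lambda>q. H (x + p *\<^sub>R b + q *\<^sub>R c)"] s by blast
    \<comment> \<open>The quotient is exactly a value of \<open>H\<close> at a point close to
      \<open>x\<close>, so continuity of \<open>H\<close> at \<open>x\<close> finishes the
      estimate.\<close>
    have "?Q s * (s * s) = ?\<phi> s - ?\<phi> 0"
      using s by (simp add: inner_diff_left inner_add_left)
    also have "\<dots> = H (x + p *\<^sub>R b + q *\<^sub>R c) * (s * s)"
      using p(3) q(3) by (simp add: inner_diff_left)
    finally have "?Q s = H (x + p *\<^sub>R b + q *\<^sub>R c)"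
      using s by simp
    then show ?thesis
      using r1(2)[of "x + p *\<^sub>R b + q *\<^sub>R c"] near[of p s q] p q s by (simp add: H_def)
  qed
  then show "eventually (\<lambda>s. dist (?Q s) ?L < \<epsilon>) (at_right 0)"
    using \<open>\<delta> > 0\<close> unfolding eventually_at_right_field by blast
qed

lemma Ck_on_2D:
  assumes "Ck_on 2 B S f" "b \<in> B" "y \<in> S"
  shows "(\<lambda>t. f (y + t *\<^sub>R b)) differentiable (at 0)"
    and "c \<in> B \<Longrightarrow> (\<lambda>t. dirderiv b f (y + t *\<^sub>R c)) differentiable (at 0)"
    and "c \<in> B \<Longrightarrow> continuous_on S (dirderiv c (dirderiv b f))"
  using assms by (auto simp: numeral_2_eq_2)

text \<open>Both mixed derivatives are limits of the same second difference quotient, and limits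
  from the right are unique. Testing against every \<open>u\<close> recovers equality of
  vectors.\<close>

theorem dirderiv_commute:
  fixes f :: "'a::euclidean_space \<Rightarrow> 'b::real_inner"
  assumes "open S" "x \<in> S" "Ck_on 2 B S f" "b \<in> B" "c \<in> B"
  shows "dirderiv c (dirderiv b f) x = dirderiv b (dirderiv c f) x"
proof (rule vector_eq_rdot[THEN iffD1, OF allI])
  fix u
  note [simp] = Ck_on_2D[OF \<open>Ck_on 2 B S f\<close>]
  let ?Q = "\<lambda>b c s. ((f (x + s *\<^sub>R b + s *\<^sub>R c) - f (x + s *\<^sub>R b) - f (x + s *\<^sub>R c) + f x) \<bullet> u) / (s * s)"
  have bc: "(?Q b c \<longlongrightarrow> dirderiv c (dirderiv b f) x \<bullet> u) (at_right 0)"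
    using assms by (intro second_difference_tendsto[of S]) auto
  have cb: "(?Q c b \<longlongrightarrow> dirderiv b (dirderiv c f) x \<bullet> u) (at_right 0)"
    using assms by (intro second_difference_tendsto[of S]) auto
  have "x + s *\<^sub>R c + s *\<^sub>R b = x + s *\<^sub>R b + s *\<^sub>R c" for s
    by (simp add: add_ac)
  \<comment> \<open>Exchanging \<open>b\<close> and \<open>c\<close> also swaps the two subtracted
    terms; the instantiated rule puts the \<open>b\<close> term first.\<close>
  then have "?Q c b = ?Q b c"
    by (simp only: cancel_ab_semigroup_add_class.diff_right_commute[of _ "f (x + _ *\<^sub>R c)" "f (x + _ *\<^sub>R b)"])
  with cb have "(?Q b c \<longlongrightarrow> dirderiv b (dirderiv c f) x \<bullet> u) (at_right 0)"
    by (simp only:)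
  with bc show "dirderiv c (dirderiv b f) x \<bullet> u = dirderiv b (dirderiv c f) x \<bullet> u"
    by (rule tendsto_unique[OF trivial_limit_at_right_real])
qed

section \<open>Matrix-valued calculus and the commutator of connections\<close>

text \<open>In finite dimension real bilinearity already implies boundedness; this supplies the
  Leibniz rule for \<open>*v\<close>.\<close>

lemma bounded_bilinear_matrix_vector_mult_complex:
  "bounded_bilinear ((*v) :: complex^'n^'m \<Rightarrow> complex^'n \<Rightarrow> complex^'m)"
  unfolding bilinear_conv_bounded_bilinear[symmetric] bilinear_def linear_iff
  by (simp add: vec_eq_iff matrix_vector_mult_def sum.distrib algebra_simps scaleR_sum_right)

lemma bounded_linear_cscale: "bounded_linear (cscale c :: complex^'n^'m \<Rightarrow> _)"
  unfolding linear_conv_bounded_linear[symmetric] linear_iff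
  by (simp add: vec_eq_iff cscale_def algebra_simps)

lemma cscale_matrix_mult:
  "cscale c P ** cscale d Q = cscale (c * d) (P ** Q)"
  by (simp add: vec_eq_iff cscale_def matrix_matrix_mult_def sum_distrib_left mult_ac)

lemma cscale_matrix_vector_mult: "cscale c P *v v = c *s (P *v v)"
  by (simp add: vec_eq_iff cscale_def matrix_vector_mult_def sum_distrib_left mult_ac)

text \<open>The computation is done for an arbitrary zeroth-order part \<open>P\<close>. It is
  differentiated only once, at \<open>x\<close>, whereas Schwarz' theorem needs
  \<open>\<psi>\<close> to be twice continuously differentiable on a neighbourhood.\<close>

lemma op_commutator_connection:
  fixes P :: "4 \<Rightarrow> real^4 \<Rightarrow> complex^'n^'n" and \<psi> :: "real^4 \<Rightarrow> complex^'n"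
  assumes "open M" "x \<in> M" and \<psi>: "Ck_on 2 Basis M \<psi>"
    and P: "\<And>\<mu> \<nu>. (\<lambda>t. P \<mu> (x + t *\<^sub>R axis \<nu> 1)) differentiable (at 0)"
    and D: "D = (\<lambda>\<mu> \<psi> y. pderiv4 \<mu> \<psi> y + P \<mu> y *v \<psi> y)"
  shows "op_commutator (D \<mu>) (D \<nu>) \<psi> x =
    (pderiv4 \<mu> (P \<nu>) x - pderiv4 \<nu> (P \<mu>) x + mat_commutator (P \<mu> x) (P \<nu> x)) *v \<psi> x"
proof -
  have B: "axis \<mu> 1 \<in> (Basis :: (real^4) set)" for \<mu>
    by (simp add: axis_in_Basis_iff)
  \<comment> \<open>The second and fourth terms are exchanged by swapping \<open>\<mu>\<close> and
    \<open>\<nu>\<close>, and the first is symmetric; only the third and fifth survive in the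
    commutator.\<close>
  have DD: "D \<mu> (D \<nu> \<psi>) x = pderiv4 \<mu> (pderiv4 \<nu> \<psi>) x + P \<nu> x *v pderiv4 \<mu> \<psi> x
      + pderiv4 \<mu> (P \<nu>) x *v \<psi> x + P \<mu> x *v pderiv4 \<nu> \<psi> x + P \<mu> x *v (P \<nu> x *v \<psi> x)" for \<mu> \<nu>
  proof -
    let ?a = "axis \<mu> 1 :: real^4"
    have 1: "((\<lambda>t. pderiv4 \<nu> \<psi> (x + t *\<^sub>R ?a)) has_vector_derivative pderiv4 \<mu> (pderiv4 \<nu> \<psi>) x) (at 0)"
      unfolding pderiv4_def
      by (intro dirderiv_has_vector_derivative Ck_on_2D[OF \<psi>] B \<open>x \<in> M\<close>)
    have 2: "((\<lambda>t. \<psi> (x + t *\<^sub>R ?a)) has_vector_derivative pderiv4 \<mu> \<psi> x) (at 0)"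
      unfolding pderiv4_def
      by (intro dirderiv_has_vector_derivative Ck_on_2D[OF \<psi>] B \<open>x \<in> M\<close>)
    have 3: "((\<lambda>t. P \<nu> (x + t *\<^sub>R ?a)) has_vector_derivative pderiv4 \<mu> (P \<nu>) x) (at 0)"
      unfolding pderiv4_def by (intro dirderiv_has_vector_derivative P)
    have "dirderiv ?a (D \<nu> \<psi>) x = pderiv4 \<mu> (pderiv4 \<nu> \<psi>) x +
        (P \<nu> x *v pderiv4 \<mu> \<psi> x + pderiv4 \<mu> (P \<nu>) x *v \<psi> x)"
      using has_vector_derivative_add[OF 1 bounded_bilinear.has_vector_derivative[OF
          bounded_bilinear_matrix_vector_mult_complex 3 2]]
      by (intro dirderiv_eqI) (simp add: D)
    then have "pderiv4 \<mu> (D \<nu> \<psi>) x = pderiv4 \<mu> (pderiv4 \<nu> \<psi>) x +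
        (P \<nu> x *v pderiv4 \<mu> \<psi> x + pderiv4 \<mu> (P \<nu>) x *v \<psi> x)"
      by (simp add: pderiv4_def)
    then show ?thesis
      by (simp add: D matrix_vector_right_distrib)
  qed
  have "pderiv4 \<mu> (pderiv4 \<nu> \<psi>) x = pderiv4 \<nu> (pderiv4 \<mu> \<psi>) x"
    using dirderiv_commute[OF \<open>open M\<close> \<open>x \<in> M\<close> \<psi> B B] by (simp add: pderiv4_def[abs_def])
  then have "op_commutator (D \<mu>) (D \<nu>) \<psi> x = pderiv4 \<mu> (P \<nu>) x *v \<psi> x - pderiv4 \<nu> (P \<mu>) x *v \<psi> x
      + (P \<mu> x *v (P \<nu> x *v \<psi> x) - P \<nu> x *v (P \<mu> x *v \<psi> x))"
    unfolding op_commutator_def DD by (simp only: algebra_simps)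
  then show ?thesis
    unfolding mat_commutator_def matrix_vector_mult_add_rdistrib matrix_vector_mult_diff_rdistrib
      matrix_vector_mul_assoc .
qed

section \<open>Differentiability of the background and the field strength\<close>

lemma smooth_onD_differentiable:
  assumes "smooth_on B S f" "b \<in> B" "x \<in> S"
  shows "(\<lambda>t. f (x + t *\<^sub>R b)) differentiable (at 0)"
  using Ck_on_2D(1)[of B S f b x] assms by (simp add: smooth_on_def)

text \<open>The absolute value is handled as the square root of a square, which is differentiable
  where \<open>f\<close> does not vanish; the outer root and the reciprocal then act on positive
  values.\<close>

lemma differentiable_inverse_sqrt_abs:
  fixes f :: "real \<Rightarrow> real"
  assumes "f differentiable (at t)" "f t \<noteq> 0"
  shows "(\<lambda>t. 1 / sqrt \<bar>f t\<bar>) differentiable (at t)"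
proof -
  have sq: "sqrt differentiable (at v)" if "v > 0" for v :: real
    using DERIV_real_sqrt[OF that] unfolding real_differentiable_def by blast
  have "(\<lambda>t. (f t)\<^sup>2) differentiable (at t)"
    by (intro differentiable_power assms)
  then have "(\<lambda>t. sqrt ((f t)\<^sup>2)) differentiable (at t)"
    using differentiable_compose[of sqrt "\<lambda>t. (f t)\<^sup>2" t UNIV] sq assms(2) by simp
  then have "(\<lambda>t. sqrt \<bar>f t\<bar>) differentiable (at t)"
    using differentiable_compose[of sqrt "\<lambda>t. \<bar>f t\<bar>" t UNIV] sq assms(2) by simp
  then show ?thesis
    using assms(2) by (intro differentiable_divide differentiable_const) simp_all
qed

text \<open>The operator identity is tested on every smooth \<open>\<psi>\<close> at every point of
  \<open>M\<close>. It is the general commutator formula with the factor \<open>\<i> * e\<close>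
  pulled out of the derivatives and squared in the matrix commutator.\<close>

theorem proposition3p6:
  fixes M :: "(real^4) set"
    and ginv :: "real^4 \<Rightarrow> real^4^4"
    and G :: "('g, 'r) monoid_scheme" and X :: "'g topology"
    and B :: "'m::euclidean_space set" and \<A> :: "('g, 'm) atlas"
    and \<rho> :: "'g \<Rightarrow> complex^'n^'n"
    and I :: "'i set" and t :: "'i \<Rightarrow> ('g \<Rightarrow> real) \<Rightarrow> 'g \<Rightarrow> real"
    and T :: "'i \<Rightarrow> complex^'n^'n"
    and \<alpha> :: "4 \<Rightarrow> 'i \<Rightarrow> real^4 \<Rightarrow> real"
    and A :: "4 \<Rightarrow> real^4 \<Rightarrow> complex^'n^'n"
    and h :: "4 \<Rightarrow> real^4 \<Rightarrow> real"
    and e :: complex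
  assumes "open M"
    and "\<And>\<mu> \<nu> x. x \<in> M \<Longrightarrow> \<mu> \<noteq> \<nu> \<Longrightarrow> ginv x $ \<mu> $ \<nu> = 0"
    and "\<And>\<mu>. smooth_on Basis M (\<lambda>x. ginv x $ \<mu> $ \<mu>)"
    and "\<And>\<mu> x. x \<in> M \<Longrightarrow> ginv x $ \<mu> $ \<mu> \<noteq> 0"
    and "h = hfac ginv"
    and "compact_lie_group G X B \<A>"
    and "lie_group_rep G B \<A> \<rho>"
    and "lie_algebra_basis G B \<A> I t"
    and "\<And>a. a \<in> I \<Longrightarrow> T a = lie_algebra_rep G \<rho> (t a)"
    and "\<And>\<mu> a. a \<in> I \<Longrightarrow> smooth_on Basis M (\<alpha> \<mu> a)"
    and "A = gauge_field I T \<alpha>"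
  shows "\<forall>\<mu> \<nu>. \<forall>\<psi> :: real^4 \<Rightarrow> complex^'n. smooth_on Basis M \<psi> \<longrightarrow> (\<forall>x\<in>M.
    field_strength e h A \<mu> \<nu> \<psi> x =
      (cscale (\<i> * e)
         (pderiv4 \<mu> (\<lambda>y. h \<nu> y *\<^sub>R A \<nu> y) x - pderiv4 \<nu> (\<lambda>y. h \<mu> y *\<^sub>R A \<mu> y) x)
       - cscale (e\<^sup>2) ((h \<mu> x * h \<nu> x) *\<^sub>R mat_commutator (A \<mu> x) (A \<nu> x))) *v \<psi> x)"
proof (intro allI impI ballI)
  fix \<mu> \<nu> and \<psi> :: "real^4 \<Rightarrow> complex^'n" and x
  assume \<psi>: "smooth_on Basis M \<psi>" and x: "x \<in> M"
  define P where "P = (\<lambda>\<mu> y. cscale (\<i> * e) (h \<mu> y *\<^sub>R A \<mu> y))"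
  have B: "axis \<mu> 1 \<in> (Basis :: (real^4) set)" for \<mu>
    by (simp add: axis_in_Basis_iff)
  have h: "(\<lambda>t. h \<mu> (x + t *\<^sub>R axis \<nu> 1)) differentiable (at 0)" for \<mu> \<nu>
    unfolding \<open>h = hfac ginv\<close> hfac_def
    using smooth_onD_differentiable[OF assms(3) B x] assms(4)[OF x]
    by (intro differentiable_inverse_sqrt_abs) simp_all
  \<comment> \<open>A Lie algebra basis is finite, so \<open>A\<close> is a finite sum of smooth
    coefficients times constant matrices.\<close>
  have "finite I"
    using assms(8) by (simp add: lie_algebra_basis_def)
  then have A: "(\<lambda>t. A \<mu> (x + t *\<^sub>R axis \<nu> 1)) differentiable (at 0)" for \<mu> \<nu>
    unfolding \<open>A = gauge_field I T \<alpha>\<close> gauge_field_def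
    by (intro differentiable_sum differentiable_scaleR differentiable_const ballI
        smooth_onD_differentiable[OF assms(10) B x])
  have hA: "(\<lambda>t. h \<mu> (x + t *\<^sub>R axis \<nu> 1) *\<^sub>R A \<mu> (x + t *\<^sub>R axis \<nu> 1)) differentiable (at 0)" for \<mu> \<nu>
    by (intro differentiable_scaleR h A)
  \<comment> \<open>This yields both the differentiability of \<open>P\<close> and the value of its
    partial derivatives.\<close>
  have dP: "((\<lambda>t. P \<mu> (x + t *\<^sub>R axis \<nu> 1)) has_vector_derivative
      cscale (\<i> * e) (pderiv4 \<nu> (\<lambda>y. h \<mu> y *\<^sub>R A \<mu> y) x)) (at 0)" for \<mu> \<nu>
    unfolding P_def pderiv4_def
    by (intro bounded_linear.has_vector_derivative[OF bounded_linear_cscale]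
        dirderiv_has_vector_derivative hA)
  have "cov_deriv e h A = (\<lambda>\<mu> \<psi> y. pderiv4 \<mu> \<psi> y + P \<mu> y *v \<psi> y)"
    by (simp add: fun_eq_iff cov_deriv_def P_def cscale_matrix_vector_mult)
  moreover have "Ck_on 2 Basis M \<psi>"
    using \<psi> by (simp add: smooth_on_def)
  moreover have "(\<lambda>t. P \<mu> (x + t *\<^sub>R axis \<nu> 1)) differentiable (at 0)" for \<mu> \<nu>
    using dP differentiableI_vector by blast
  ultimately have "field_strength e h A \<mu> \<nu> \<psi> x =
      (pderiv4 \<mu> (P \<nu>) x - pderiv4 \<nu> (P \<mu>) x + mat_commutator (P \<mu> x) (P \<nu> x)) *v \<psi> x"
    unfolding field_strength_def using op_commutator_connection[OF \<open>open M\<close> x] by blast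
  moreover have "pderiv4 \<nu> (P \<mu>) x = cscale (\<i> * e) (pderiv4 \<nu> (\<lambda>y. h \<mu> y *\<^sub>R A \<mu> y) x)" for \<mu> \<nu>
    unfolding pderiv4_def[of \<nu> "P \<mu>"] by (rule dirderiv_eqI[OF dP])
  \<comment> \<open>The minus sign is the square of \<open>\<i>\<close>; the real factors
    \<open>h\<close> commute with all matrices.\<close>
  moreover have "mat_commutator (P \<mu> x) (P \<nu> x) =
      - cscale (e\<^sup>2) ((h \<mu> x * h \<nu> x) *\<^sub>R mat_commutator (A \<mu> x) (A \<nu> x))"
  proof -
    have "(a *\<^sub>R M) ** (b *\<^sub>R N) = (a * b) *\<^sub>R (M ** N)" for a b and M N :: "complex^'n^'n"
      by (simp add: vec_eq_iff matrix_matrix_mult_def scaleR_sum_right mult.commute[of b a])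
    then show ?thesis
      by (simp add: P_def mat_commutator_def cscale_matrix_mult)
        (simp add: vec_eq_iff cscale_def power2_eq_square algebra_simps)
  qed
  ultimately show "field_strength e h A \<mu> \<nu> \<psi> x =
      (cscale (\<i> * e)
         (pderiv4 \<mu> (\<lambda>y. h \<nu> y *\<^sub>R A \<nu> y) x - pderiv4 \<nu> (\<lambda>y. h \<mu> y *\<^sub>R A \<mu> y) x)
       - cscale (e\<^sup>2) ((h \<mu> x * h \<nu> x) *\<^sub>R mat_commutator (A \<mu> x) (A \<nu> x))) *v \<psi> x"
    by (simp only: linear_diff[OF bounded_linear.linear[OF bounded_linear_cscale]]
        add_uminus_conv_diff)
qed

end
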